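(* (Semi-discrete conservation of momentum.) Consider a solution of the semi-discrete penalized Legendre-Fourier Vlasov-Poisson system $$\frac{d\mathbf{C}^s_k}{dt}+\Big(\frac{2\pi i}{L}k\Big)\mathbb{A}\mathbf{C}^s_k-\frac{q^s}{m^s}\Big[E\star\big(\mathbb{B}\mathbf{C}^s-\gamma^s\delta_v[f^s\boldsymbol\phi]_{v_a}^{v_b}\big)\Big]_k=\mathbb{D}^s_\nu\mathbf{C}^s_k,\qquad -N_F\le k\le N_F,\ s\in\{e,i\}.$$ Then the total momentum $P(t)=\sum_{s\in\{e,i\}}m^s\int_0^L\int_{v_a}^{v_b}v f^s(x,v,t)\,dv\,dx$ satisfies $$\frac{dP}{dt}=-(v_b-v_a)L\sum_{s\in\{e,i\}}q^s\gamma^s\Big[E\star\big(\overline\sigma\,\delta_v[f^s\phi_0]_{v_a}^{v_b}+\sigma_1\,\delta_v[f^s\phi_1]_{v_a}^{v_b}\big)\Big]_0 ,$$ and the right-hand side is zero if $f^s(x,v_a,t)=f^s(x,v_b,t)=0$ for all $x\in[0,L]$ and $s\in\{e,i\}$.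
   Context: Let $L>0$, $v_a<v_b$, integers $N_L\ge4$, $N_F\ge0$; species $s\in\{e,i\}$ have mass $m^s>0$ and charge $q^s\in\mathbb{R}$; $\epsilon_0>0$; $\gamma^s\in\mathbb{R}$ is a penalty coefficient and $\nu_s\ge0$ a collision coefficient. Let $L_n$ be the Legendre polynomials on $[-1,1]$ ($L_0=1$, $L_1(\eta)=\eta$, $(2n+1)\eta L_n=(n+1)L_{n+1}+nL_{n-1}$), $\phi_n(v)=\sqrt{2n+1}\,L_n\big((2v-(v_a+v_b))/(v_b-v_a)\big)$, $\boldsymbol\phi=(\phi_0,\dots,\phi_{N_L-1})^T$, $\psi_k(x)=e^{2\pi i kx/L}$. Constants: $\overline\sigma=\frac{v_a+v_b}{2}$, $\sigma_0=0$, $\sigma_n=\frac{v_b-v_a}{2}\frac{n}{\sqrt{(2n+1)(2n-1)}}$ for $n\ge1$; $\sigma_{n,i}=\pi_{n,i}\frac{2\sqrt{(2n+1)(2i+1)}}{v_b-v_a}$ with $\pi_{n,i}=0$ if $n-i$ is even, $1$ if odd. $f^s(x,v,t)=\sum_{n=0}^{N_L-1}C^s_n(x,t)\phi_n(v)$, $C^s_n(x,t)=\sum_{k=-N_F}^{N_F}C^s_{n,k}(t)\psi_k(x)$ (real-valued), $\mathbf{C}^s=(C^s_n)_{n=0}^{N_L-1}$, $\mathbf{C}^s_k=(C^s_{n,k})_{n=0}^{N_L-1}$, with conventions $C^s_{-1}=C^s_{N_L}=0$. Matrices: $(\mathbb{A}\mathbf{C}^s_k)_n=\sigma_{n+1}C^s_{n+1,k}+\sigma_nC^s_{n-1,k}+\overline\sigma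 C^s_{n,k}$; $(\mathbb{B}\mathbf{C}^s)_n=\sum_{i=0}^{n-1}\sigma_{n,i}C^s_i$; $\mathbb{D}^s_\nu$ is diagonal with entries $D^s_n=-\nu_s\frac{n(n-1)(n-2)}{(N_L-1)(N_L-2)(N_L-3)}$. The electric field $E(x,t)=\sum_{k=-N_F}^{N_F}E_k(t)\psi_k(x)$ is real-valued, with $E_0=0$ and (Poisson equation) $\epsilon_0\big(\frac{2\pi i}{L}k\big)E_k=(v_b-v_a)\sum_{s\in\{e,i\}}q^sC^s_{0,k}$ for $k\ne0$. For $g(x,v,t)$, $\delta_v[g]_{v_a}^{v_b}=\frac{g(x,v_b,t)-g(x,v_a,t)}{v_b-v_a}$. For a trigonometric polynomial $h(x)$ (possibly vector-valued) with Fourier coefficients $h_j=\frac1L\int_0^Lh\,\psi_{-j}\,dx$, $[E\star h]_k=\sum_{k'=-N_F}^{N_F}E_{k'}h_{k-k'}$. *)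

theory Defs
  imports "HOL-Analysis.Analysis"
begin

datatype species = Electron | Ion

fun legendre :: "nat \<Rightarrow> real \<Rightarrow> real" where
  "legendre 0 \<eta> = 1"
| "legendre (Suc 0) \<eta> = \<eta>"
| "legendre (Suc (Suc n)) \<eta> =
     ((2 * real (Suc n) + 1) * \<eta> * legendre (Suc n) \<eta> - real (Suc n) * legendre n \<eta>)
       / (real (Suc n) + 1)"

definition phi :: "real \<Rightarrow> real \<Rightarrow> nat \<Rightarrow> real \<Rightarrow> real" where
  "phi va vb n v = sqrt (2 * real n + 1) * legendre n ((2 * v - (va + vb)) / (vb - va))"

definition psi :: "real \<Rightarrow> int \<Rightarrow> real \<Rightarrow> complex" where
  "psi L k x = exp (2 * of_real pi * \<i> * of_int k * of_real x / of_real L)"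

definition sigma_bar :: "real \<Rightarrow> real \<Rightarrow> real" where
  "sigma_bar va vb = (va + vb) / 2"

definition sigma1 :: "real \<Rightarrow> real \<Rightarrow> nat \<Rightarrow> real" where
  "sigma1 va vb n =
     (if n = 0 then 0
      else (vb - va) / 2 * (real n / sqrt ((2 * real n + 1) * (2 * real n - 1))))"

definition sigma2 :: "real \<Rightarrow> real \<Rightarrow> nat \<Rightarrow> nat \<Rightarrow> real" where
  "sigma2 va vb n i =
     (if even (int n - int i) then 0 else 1)
       * (2 * sqrt ((2 * real n + 1) * (2 * real i + 1)) / (vb - va))"

text \<open>Vectors of Legendre coefficients are functions on \<^typ>\<open>nat\<close> of which only the entries
  \<open>0, \<dots>, NL - 1\<close> are used; the guards in \<open>matA\<close> are the conventions that the entries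
  with index \<open>-1\<close> and \<open>NL\<close> vanish.\<close>

definition matA :: "real \<Rightarrow> real \<Rightarrow> nat \<Rightarrow> (nat \<Rightarrow> complex) \<Rightarrow> nat \<Rightarrow> complex" where
  "matA va vb NL u n =
     of_real (sigma1 va vb (n + 1)) * (if n + 1 < NL then u (n + 1) else 0)
     + of_real (sigma1 va vb n) * (if n = 0 then 0 else u (n - 1))
     + of_real (sigma_bar va vb) * u n"

definition matB :: "real \<Rightarrow> real \<Rightarrow> (nat \<Rightarrow> complex) \<Rightarrow> nat \<Rightarrow> complex" where
  "matB va vb u n = (\<Sum>i<n. of_real (sigma2 va vb n i) * u i)"

definition matD :: "nat \<Rightarrow> real \<Rightarrow> (nat \<Rightarrow> complex) \<Rightarrow> nat \<Rightarrow> complex" where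
  "matD NL \<nu> u n =
     of_real (- \<nu> * (real n * (real n - 1) * (real n - 2)
       / ((real NL - 1) * (real NL - 2) * (real NL - 3)))) * u n"

definition trig_poly :: "real \<Rightarrow> nat \<Rightarrow> (int \<Rightarrow> complex) \<Rightarrow> real \<Rightarrow> complex" where
  "trig_poly L NF c x = (\<Sum>k\<in>{- int NF..int NF}. c k * psi L k x)"

definition vdf ::
  "real \<Rightarrow> real \<Rightarrow> real \<Rightarrow> nat \<Rightarrow> nat \<Rightarrow> (nat \<Rightarrow> int \<Rightarrow> complex) \<Rightarrow> real \<Rightarrow> real \<Rightarrow> complex" where
  "vdf L va vb NL NF c x v =
     (\<Sum>n<NL. trig_poly L NF (c n) x * of_real (phi va vb n v))"

definition delta_v :: "real \<Rightarrow> real \<Rightarrow> (real \<Rightarrow> complex) \<Rightarrow> complex" where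
  "delta_v va vb g = (g vb - g va) / of_real (vb - va)"

definition fourier_coeff :: "real \<Rightarrow> (real \<Rightarrow> complex) \<Rightarrow> int \<Rightarrow> complex" where
  "fourier_coeff L h j = 1 / of_real L * integral {0..L} (\<lambda>x. h x * psi L (- j) x)"

definition conv ::
  "real \<Rightarrow> nat \<Rightarrow> (int \<Rightarrow> complex) \<Rightarrow> (real \<Rightarrow> complex) \<Rightarrow> int \<Rightarrow> complex" where
  "conv L NF e h k = (\<Sum>k'\<in>{- int NF..int NF}. e k' * fourier_coeff L h (k - k'))"

definition momentum ::
  "real \<Rightarrow> real \<Rightarrow> real \<Rightarrow> (species \<Rightarrow> real) \<Rightarrow> (species \<Rightarrow> real \<Rightarrow> real \<Rightarrow> complex) \<Rightarrow> complex" where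
  "momentum L va vb m f =
     (\<Sum>s\<in>{Electron, Ion}. of_real (m s) *
        integral {0..L} (\<lambda>x. integral {va..vb} (\<lambda>v. of_real v * f s x v)))"

end

theory Submission
  imports Defs
begin

text \<open>The momentum only sees two coefficients per species. Since
  \<open>v = sigma_bar * phi_0 + sigma_1 * phi_1\<close>, the orthogonality of the Legendre polynomials in
  \<open>v\<close> and of the exponentials in \<open>x\<close> makes the momentum of a truncated expansion equal to
  \<open>L (vb - va) (\<Sum>s. m s (sigma_bar C_{0,0} + sigma_1 C_{1,0}))\<close>, where \<open>C_{n,k}\<close> is the coefficient of
  Legendre degree \<open>n\<close> and wave number \<open>k\<close> (lemma \<open>momentum_vdf\<close>).

  In the evolution equations for \<open>C_{0,0}\<close> and \<open>C_{1,0}\<close> the transport term carries the factor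
  \<open>k = 0\<close> and the collision term carries the factor \<open>n (n - 1) (n - 2) = 0\<close>, so only the field term is
  left. Its penalty part gives the asserted right-hand side. The matrix \<open>B\<close> contributes only for
  \<open>n = 1\<close>, and there \<open>sigma_1\<close> cancels the entry \<open>(1, 0)\<close> of \<open>B\<close> (lemma \<open>sigma1_sigma2\<close>); what is left
  of this part is a multiple of the total force \<open>\<Sum>k. E_k \<rho>_{-k}\<close>, with
  \<open>\<rho>_k = (\<Sum>s. q s C_{0,k})\<close>. The Poisson equation turns the summand into a multiple of
  \<open>k E_k E_{-k}\<close>, which is odd in \<open>k\<close>, so the force is zero (lemma \<open>poisson_force_zero\<close>).

  If \<open>f\<close> vanishes at both velocity boundaries, then so do all the boundary differences, and with them
  the right-hand side.\<close>

section \<open>Moments of the Legendre polynomials\<close>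

text \<open>As a simplification rule the three-term recursion would expand every \<open>legendre (Suc (Suc n))\<close>,
  also below \<open>deriv\<close>, where the identities of this section no longer match.\<close>


declare legendre.simps(3) [simp del]

lemma legendre_differentiable: "legendre n differentiable at x"
proof (induction n rule: induct_nat_012)
  case 0
  have "legendre 0 = (\<lambda>\<eta>. 1)" by auto
  then show ?case by simp
next
  case 1
  have "legendre (Suc 0) = (\<lambda>\<eta>. \<eta>)" by auto
  then show ?case by simp
next
  case (ge2 n)
  have "legendre (Suc (Suc n)) = (\<lambda>\<eta>. ((2 * real (Suc n) + 1) * \<eta> * legendre (Suc n) \<eta>
      - real (Suc n) * legendre n \<eta>) / (real (Suc n) + 1))" by (auto simp: legendre.simps(3))
  then show ?case using ge2 by (auto intro!: derivative_intros)
qed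

lemma legendre_has_deriv:
  "(legendre n has_real_derivative deriv (legendre n) x) (at x)"
  using legendre_differentiable
  by (simp add: DERIV_deriv_iff_real_differentiable)

lemma legendre_deriv_rec:
  "(real n + 2) * deriv (legendre (Suc (Suc n))) x =
     (2 * real n + 3) * (legendre (Suc n) x + x * deriv (legendre (Suc n)) x)
       - (real n + 1) * deriv (legendre n) x"
proof -
  have e: "legendre (Suc (Suc n)) = (\<lambda>\<eta>. ((2 * real (Suc n) + 1) * \<eta> * legendre (Suc n) \<eta>
      - real (Suc n) * legendre n \<eta>) / (real (Suc n) + 1))" by (auto simp: legendre.simps(3))
  have "((\<lambda>\<eta>. (2 * real (Suc n) + 1) * \<eta> * legendre (Suc n) \<eta> - real (Suc n) * legendre n \<eta>)
      has_real_derivative (2 * real n + 3) * (legendre (Suc n) x + x * deriv (legendre (Suc n)) x)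
       - (real n + 1) * deriv (legendre n) x) (at x)"
    by (rule derivative_eq_intros legendre_has_deriv refl | simp add: algebra_simps)+
  from DERIV_imp_deriv[OF DERIV_cdivide[OF this, of "real (Suc n) + 1"]]
  have "deriv (legendre (Suc (Suc n))) x =
      ((2 * real n + 3) * (legendre (Suc n) x + x * deriv (legendre (Suc n)) x)
       - (real n + 1) * deriv (legendre n) x) / (real n + 2)"
    unfolding e by (simp add: add_ac)
  moreover have "real n + 2 \<noteq> 0" by simp
  ultimately show ?thesis by (simp only: times_divide_eq_right nonzero_mult_div_cancel_left not_False_eq_True)
qed

lemma legendre_rec:
  "(real n + 2) * legendre (Suc (Suc n)) x =
     (2 * real n + 3) * x * legendre (Suc n) x - (real n + 1) * legendre n x"
  by (simp add: legendre.simps(3) add_ac)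

lemma times_legendre:
  "x * legendre n x = ((real n + 1) * legendre (Suc n) x + real n * legendre (n - 1) x) / (2 * real n + 1)"
proof (cases n)
  case (Suc k)
  then show ?thesis using legendre_rec[of k x] by (simp add: field_simps)
qed simp

text \<open>Each of the two classical identities is needed for the inductive step of the other.\<close>

lemma legendre_deriv_identities:
  "deriv (legendre (Suc n)) x = x * deriv (legendre n) x + (real n + 1) * legendre n x
   \<and> x * deriv (legendre (Suc n)) x - deriv (legendre n) x = (real n + 1) * legendre (Suc n) x"
proof (induction n)
  case 0
  have "legendre 0 = (\<lambda>\<eta>. 1)" "legendre (Suc 0) = (\<lambda>\<eta>. \<eta>)" by auto
  then show ?case by simp
next
  case (Suc n)
  let ?d = "\<lambda>n. deriv (legendre n) x" and ?P = "\<lambda>n. legendre n x"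
  have dn: "?d n = x * ?d (Suc n) - (real n + 1) * ?P (Suc n)"
    and ds: "?d (Suc n) = x * ?d n + (real n + 1) * ?P n"
    using Suc.IH by auto
  have "(real n + 2) * ?d (Suc (Suc n)) = (real n + 2) * (x * ?d (Suc n) + (real n + 2) * ?P (Suc n))"
    unfolding legendre_deriv_rec dn by (simp add: algebra_simps)
  then have 1: "?d (Suc (Suc n)) = x * ?d (Suc n) + (real n + 2) * ?P (Suc n)" by simp
  have "x * (x * ?d (Suc n)) = ?d (Suc n) - (real n + 1) * ?P n + (real n + 1) * x * ?P (Suc n)"
    using dn ds by algebra
  then have "x * ?d (Suc (Suc n)) - ?d (Suc n) = (real n + 2) * ?P (Suc (Suc n))"
    unfolding 1 legendre_rec by (simp add: algebra_simps)
  with 1 show ?case by (simp add: add_ac)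
qed

text \<open>This identity exhibits an antiderivative of every Legendre polynomial of positive degree. Its
  values at the end points cancel because the degrees \<open>n\<close> and \<open>n + 2\<close> have the same parity.\<close>

lemma legendre_deriv_diff:
  "deriv (legendre (Suc (Suc n))) x - deriv (legendre n) x = (2 * real n + 3) * legendre (Suc n) x"
  using legendre_deriv_identities[of "Suc n" x, THEN conjunct1]
    legendre_deriv_identities[of n x, THEN conjunct2]
  by (simp add: algebra_simps)

lemma legendre_at_1: "legendre n 1 = 1"
  by (induction n rule: induct_nat_012) (auto simp: legendre.simps(3))

lemma legendre_at_minus_1: "legendre n (- 1) = (- 1) ^ n"
  by (induction n rule: induct_nat_012) (auto simp: legendre.simps(3) field_simps)

lemma has_integral_legendre_affine:
  fixes va vb :: real
  assumes "va < vb"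
  shows "((\<lambda>v. legendre n ((2 * v - (va + vb)) / (vb - va)))
           has_integral (if n = 0 then vb - va else 0)) {va..vb}"
proof (cases n)
  case 0
  then show ?thesis using assms has_integral_const_real[of "1::real" va vb] by simp
next
  case (Suc k)
  let ?e = "\<lambda>v. (2 * v - (va + vb)) / (vb - va)"
  let ?F = "\<lambda>v. (vb - va) / (2 * (2 * real k + 3)) * (legendre (Suc (Suc k)) (?e v) - legendre k (?e v))"
  have de: "(?e has_real_derivative 2 / (vb - va)) (at v)" for v
    using assms by (auto intro!: derivative_eq_intros simp: divide_simps)
  have "(?F has_real_derivative (vb - va) / (2 * (2 * real k + 3)) *
      (deriv (legendre (Suc (Suc k))) (?e v) * (2 / (vb - va)) - deriv (legendre k) (?e v) * (2 / (vb - va)))) (at v)" for v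
    by (intro DERIV_cmult DERIV_diff DERIV_chain2[OF legendre_has_deriv de])
  moreover have "(vb - va) / (2 * (2 * real k + 3)) *
      (deriv (legendre (Suc (Suc k))) (?e v) * (2 / (vb - va)) - deriv (legendre k) (?e v) * (2 / (vb - va)))
      = legendre (Suc k) (?e v)" for v
  proof -
    have "(vb - va) / (2 * a) * (a * p * (2 / (vb - va))) = p" if "a > 0" for a p :: real
      using assms that by simp
    moreover have "2 * real k + 3 > 0" by linarith
    ultimately show ?thesis
      unfolding left_diff_distrib[symmetric] legendre_deriv_diff by blast
  qed
  ultimately have "(?F has_real_derivative legendre (Suc k) (?e v)) (at v)" for v
    by simp
  then have "((\<lambda>v. legendre (Suc k) (?e v)) has_integral (?F vb - ?F va)) {va..vb}"
    using assms
    by (intro fundamental_theorem_of_calculus)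
       (auto simp: has_real_derivative_iff_has_vector_derivative[symmetric]
             intro: has_field_derivative_at_within)
  moreover have "?e vb = 1" "?e va = - 1"
    using assms by (auto simp: field_simps)
  ultimately show ?thesis
    using Suc by (simp add: legendre_at_1 legendre_at_minus_1)
qed

text \<open>The velocity is an affine function of the Legendre variable, so the recursion reduces the first
  moment to integrals of the degrees \<open>n - 1\<close>, \<open>n\<close> and \<open>n + 1\<close>.\<close>

lemma has_integral_velocity_phi:
  fixes va vb :: real
  assumes "va < vb"
  shows "((\<lambda>v. v * phi va vb n v) has_integral
           (vb - va) * (if n = 0 then sigma_bar va vb else if n = 1 then sigma1 va vb 1 else 0)) {va..vb}"
proof -
  let ?e = "\<lambda>v. (2 * v - (va + vb)) / (vb - va)"
  let ?P = "\<lambda>k v. legendre k (?e v)"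
  let ?c = "(vb - va) / (2 * (2 * real n + 1))"
  have v: "v = sigma_bar va vb + (vb - va) / 2 * ?e v" for v
    using assms by (simp add: sigma_bar_def field_simps)
  have "v * phi va vb n v = sqrt (2 * real n + 1) *
      (sigma_bar va vb * ?P n v + (?c * (real n + 1)) * ?P (Suc n) v + (?c * real n) * ?P (n - 1) v)" for v
  proof -
    have "v * ?P n v = (sigma_bar va vb + (vb - va) / 2 * ?e v) * ?P n v"
      by (rule arg_cong[OF v])
    also have "\<dots> = sigma_bar va vb * ?P n v + (vb - va) / 2 * (?e v * ?P n v)"
      by (simp only: distrib_right mult.assoc)
    also have "\<dots> = sigma_bar va vb * ?P n v + (?c * (real n + 1)) * ?P (Suc n) v + (?c * real n) * ?P (n - 1) v"
    proof -
      have "w / 2 * ((a * p + b * r) / d) = w / (2 * d) * a * p + w / (2 * d) * b * r"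
        for a b d p r w :: real
        by (simp add: add_divide_distrib algebra_simps)
      then show ?thesis unfolding times_legendre by (simp only: add.assoc)
    qed
    finally show ?thesis by (simp add: phi_def)
  qed
  moreover have "((\<lambda>v. sqrt (2 * real n + 1) *
      (sigma_bar va vb * ?P n v + (?c * (real n + 1)) * ?P (Suc n) v + (?c * real n) * ?P (n - 1) v))
      has_integral sqrt (2 * real n + 1) *
      (sigma_bar va vb * (if n = 0 then vb - va else 0) + (?c * (real n + 1)) * (if Suc n = 0 then vb - va else 0)
       + (?c * real n) * (if n - 1 = 0 then vb - va else 0))) {va..vb}"
    by (intro has_integral_mult_right has_integral_add has_integral_legendre_affine assms)
  moreover have "sqrt (2 * real n + 1) *
      (sigma_bar va vb * (if n = 0 then vb - va else 0) + (?c * (real n + 1)) * (if Suc n = 0 then vb - va else 0)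
       + (?c * real n) * (if n - 1 = 0 then vb - va else 0))
      = (vb - va) * (if n = 0 then sigma_bar va vb else if n = 1 then sigma1 va vb 1 else 0)"
  proof -
    have "sqrt 3 * ((vb - va) / 6 * (vb - va)) = (vb - va) * ((vb - va) / 2 * (1 / sqrt 3))"
      by (simp add: field_simps)
    then show ?thesis by (cases "n = 0"; cases "n = 1") (auto simp: sigma1_def)
  qed
  ultimately show ?thesis by simp
qed

section \<open>Fourier coefficients and the convolution\<close>

lemma psi_0 [simp]: "psi L 0 x = 1"
  by (simp add: psi_def)

lemma psi_mult: "psi L j x * psi L k x = psi L (j + k) x"
  by (simp add: psi_def exp_add[symmetric] add_divide_distrib algebra_simps)

lemma continuous_on_psi [continuous_intros]: "continuous_on S (psi L k)"
  unfolding psi_def divide_inverse by (intro continuous_intros)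

lemma has_integral_psi:
  assumes "L > 0"
  shows "(psi L k has_integral (if k = 0 then of_real L else 0)) {0..L}"
proof (cases "k = 0")
  case True
  then have "psi L k = (\<lambda>x. 1)" by auto
  then show ?thesis using True assms has_integral_const_real[of "1::complex" 0 L]
    by (simp add: scaleR_conv_of_real)
next
  case False
  let ?a = "2 * of_real pi * \<i> * of_int k / of_real L :: complex"
  have a: "?a \<noteq> 0" using False assms by simp
  have psi: "psi L k x = exp (?a * of_real x)" for x
    by (simp add: psi_def)
  have "((\<lambda>x. exp (?a * of_real x) / ?a) has_vector_derivative psi L k x) (at x within {0..L})" for x
  proof -
    have "((\<lambda>z. exp (?a * z) / ?a) has_field_derivative exp (?a * of_real x)) (at (of_real x))"
      using a by (auto intro!: derivative_eq_intros)
    from has_vector_derivative_real_field[OF this] show ?thesis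
      unfolding psi .
  qed
  then have "(psi L k has_integral exp (?a * of_real L) / ?a - exp (?a * of_real 0) / ?a) {0..L}"
    using assms by (intro fundamental_theorem_of_calculus) auto
  moreover have "exp (?a * of_real L) = 1"
  proof -
    have "?a * of_real L = \<i> * (of_int k * (of_real pi * 2))" using assms by simp
    also have "exp \<dots> = 1" by (rule exp_2pi_1_int)
    finally show ?thesis .
  qed
  ultimately show ?thesis using False by simp
qed

lemma continuous_on_trig_poly [continuous_intros]: "continuous_on S (trig_poly L NF c)"
  unfolding trig_poly_def by (intro continuous_intros)

lemma has_integral_trig_poly_psi:
  assumes "L > 0" "j \<in> {- int NF..int NF}"
  shows "((\<lambda>x. trig_poly L NF c x * psi L (- j) x) has_integral of_real L * c j) {0..L}"
proof -
  have "((\<lambda>x. \<Sum>k\<in>{- int NF..int NF}. c k * psi L (k - j) x) has_integral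
      (\<Sum>k\<in>{- int NF..int NF}. c k * (if k - j = 0 then of_real L else 0))) {0..L}"
    by (intro has_integral_sum has_integral_mult_right has_integral_psi assms) auto
  moreover have "(\<Sum>k\<in>{- int NF..int NF}. c k * (if k - j = 0 then of_real L else 0))
      = (\<Sum>k\<in>{- int NF..int NF}. if k = j then of_real L * c j else 0)"
    by (intro sum.cong) auto
  ultimately show ?thesis using assms(2)
    by (simp add: trig_poly_def sum_distrib_right mult.assoc psi_mult)
qed

lemma fourier_coeff_trig_poly:
  assumes "L > 0" "j \<in> {- int NF..int NF}"
  shows "fourier_coeff L (trig_poly L NF c) j = c j"
  using integral_unique[OF has_integral_trig_poly_psi[OF assms]] assms(1)
  by (simp add: fourier_coeff_def)

lemma conv_trig_poly_0:
  assumes "L > 0"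
  shows "conv L NF e (trig_poly L NF c) 0 = (\<Sum>k\<in>{- int NF..int NF}. e k * c (- k))"
  unfolding conv_def using assms by (intro sum.cong) (auto simp: fourier_coeff_trig_poly)

lemma conv_add:
  assumes "continuous_on {0..L} g" "continuous_on {0..L} h"
  shows "conv L NF e (\<lambda>x. g x + h x) k = conv L NF e g k + conv L NF e h k"
proof -
  have "integral {0..L} (\<lambda>x. (g x + h x) * psi L j x)
      = integral {0..L} (\<lambda>x. g x * psi L j x) + integral {0..L} (\<lambda>x. h x * psi L j x)" for j
    unfolding distrib_right
    by (intro integral_add integrable_continuous_real continuous_intros assms)
  then show ?thesis
    by (simp add: conv_def fourier_coeff_def add_divide_distrib distrib_left sum.distrib)
qed

lemma conv_cmult: "conv L NF e (\<lambda>x. c * h x) k = c * conv L NF e h k"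
  by (simp add: conv_def fourier_coeff_def mult.assoc sum_distrib_left mult.left_commute)

lemma conv_eq_0:
  assumes "\<And>x. x \<in> {0..L} \<Longrightarrow> h x = 0"
  shows "conv L NF e h k = 0"
proof -
  have "integral {0..L} (\<lambda>x. h x * psi L j x) = integral {0..L} (\<lambda>x. 0)" for j
    by (rule integral_cong) (simp add: assms)
  then show ?thesis by (simp add: conv_def fourier_coeff_def)
qed

lemma sum_odd_eq_0:
  fixes g :: "int \<Rightarrow> 'a :: field_char_0"
  assumes "\<And>k. g (- k) = - g k"
  shows "(\<Sum>k\<in>{- N..N}. g k) = 0"
proof -
  have "(\<Sum>k\<in>{- N..N}. g k) = (\<Sum>k\<in>{- N..N}. g (- k))"
    by (rule sum.reindex_bij_witness[of _ uminus uminus]) auto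
  also have "\<dots> = - (\<Sum>k\<in>{- N..N}. g k)"
    by (simp add: assms sum_negf)
  finally have "2 * (\<Sum>k\<in>{- N..N}. g k) = 0"
    by (simp only: mult_2 eq_neg_iff_add_eq_0)
  then show ?thesis by simp
qed

text \<open>A self-consistent field exerts no net force: \<open>e\<close> stands for the Fourier coefficients of the
  field and \<open>c\<close> for those of the charge density.\<close>

lemma poisson_force_zero:
  fixes a b :: complex and c e :: "int \<Rightarrow> complex"
  assumes "b \<noteq> 0" and "\<And>k. k \<in> {- N..N} \<Longrightarrow> k \<noteq> 0 \<Longrightarrow> a * of_int k * e k = b * c k"
    and "e 0 = 0"
  shows "(\<Sum>k\<in>{- N..N}. e k * c (- k)) = 0"
proof -
  let ?g = "\<lambda>k. a * of_int k * e k * e (- k)"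
  have "b * (e k * c (- k)) = ?g (- k)" if "k \<in> {- N..N}" for k
    using assms(2)[of "- k"] assms(3) that by (cases "k = 0") (auto simp: algebra_simps)
  then have "b * (\<Sum>k\<in>{- N..N}. e k * c (- k)) = (\<Sum>k\<in>{- N..N}. ?g (- k))"
    by (simp add: sum_distrib_left)
  also have "\<dots> = 0"
    by (rule sum_odd_eq_0) simp
  finally show ?thesis using assms(1) by simp
qed

section \<open>The momentum of a truncated expansion\<close>

lemma continuous_on_delta_v [continuous_intros]:
  assumes "continuous_on S (\<lambda>x. g x vb)" "continuous_on S (\<lambda>x. g x va)"
  shows "continuous_on S (\<lambda>x. delta_v va vb (g x))"
  unfolding delta_v_def divide_inverse by (intro continuous_intros assms)

lemma continuous_on_vdf [continuous_intros]: "continuous_on S (\<lambda>x. vdf L va vb NL NF c x v)"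
  unfolding vdf_def by (intro continuous_intros)

lemma momentum_vdf:
  assumes "L > 0" "va < vb" "NL \<ge> 2"
  shows "momentum L va vb m (\<lambda>s. vdf L va vb NL NF (c s)) =
    of_real (L * (vb - va)) * (\<Sum>s\<in>{Electron, Ion}. of_real (m s) *
      (of_real (sigma_bar va vb) * c s 0 0 + of_real (sigma1 va vb 1) * c s 1 0))"
proof -
  \<comment> \<open>the first velocity moment of \<open>phi_n\<close>\<close>
  let ?\<mu> = "\<lambda>n. (vb - va) * (if n = 0 then sigma_bar va vb else if n = 1 then sigma1 va vb 1 else 0)"
  have 1: "integral {va..vb} (\<lambda>v. of_real v * vdf L va vb NL NF d x v)
      = (\<Sum>n<NL. trig_poly L NF (d n) x * of_real (?\<mu> n))" for d x
  proof (rule integral_unique)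
    have "((\<lambda>v. complex_of_real (v * phi va vb n v)) has_integral of_real (?\<mu> n)) {va..vb}" for n
      using has_integral_linear[OF has_integral_velocity_phi[OF assms(2)] bounded_linear_of_real]
      unfolding o_def .
    then have "((\<lambda>v. \<Sum>n<NL. trig_poly L NF (d n) x * of_real (v * phi va vb n v))
        has_integral (\<Sum>n<NL. trig_poly L NF (d n) x * of_real (?\<mu> n))) {va..vb}"
      by (intro has_integral_sum has_integral_mult_right) auto
    then show "((\<lambda>v. of_real v * vdf L va vb NL NF d x v)
        has_integral (\<Sum>n<NL. trig_poly L NF (d n) x * of_real (?\<mu> n))) {va..vb}"
      by (simp add: vdf_def sum_distrib_left mult_ac)
  qed
  have 2: "integral {0..L} (\<lambda>x. \<Sum>n<NL. trig_poly L NF (d n) x * of_real (?\<mu> n))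
      = (\<Sum>n<NL. of_real L * d n 0 * of_real (?\<mu> n))" for d
    using has_integral_trig_poly_psi[OF assms(1), of 0 NF]
    by (intro integral_unique has_integral_sum has_integral_mult_left) auto
  have 3: "(\<Sum>n<NL. of_real L * d n 0 * of_real (?\<mu> n))
      = complex_of_real (L * (vb - va)) * (of_real (sigma_bar va vb) * d 0 0 + of_real (sigma1 va vb 1) * d 1 0)"
    for d :: "nat \<Rightarrow> int \<Rightarrow> complex"
  proof -
    have "(\<Sum>n<NL. of_real L * d n 0 * of_real (?\<mu> n)) = (\<Sum>n\<in>{0, 1}. of_real L * d n 0 * of_real (?\<mu> n))"
      using assms(3) by (intro sum.mono_neutral_right) auto
    also have "\<dots> = of_real (L * (vb - va)) *
        (of_real (sigma_bar va vb) * d 0 0 + of_real (sigma1 va vb 1) * d 1 0)"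
      by (simp add: algebra_simps)
    finally show ?thesis .
  qed
  show ?thesis
    unfolding momentum_def 1 2 3 by (simp only: sum_distrib_left mult_ac)
qed

text \<open>This is the discrete form of the fact that, up to boundary terms, integrating \<open>v\<close> against
  \<open>- df / dv\<close> gives the density.\<close>

lemma sigma1_sigma2:
  assumes "va < vb"
  shows "sigma1 va vb 1 * sigma2 va vb 1 0 = 1"
  using assms by (simp add: sigma1_def sigma2_def field_simps)

section \<open>Conservation of momentum\<close>

theorem mainTheorem5:
  fixes L va vb \<epsilon>0 :: real
    and NL NF :: nat
    and m q \<gamma> \<nu> :: "species \<Rightarrow> real"
    and T :: "real set"
    and C C' :: "species \<Rightarrow> nat \<Rightarrow> int \<Rightarrow> real \<Rightarrow> complex"
    and E :: "int \<Rightarrow> real \<Rightarrow> complex"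
    and f :: "species \<Rightarrow> real \<Rightarrow> real \<Rightarrow> real \<Rightarrow> complex"
  assumes L_pos: "L > 0"
    and va_vb: "va < vb"
    and NL_ge: "NL \<ge> 4"
    and m_pos: "\<And>s. m s > 0"
    and eps_pos: "\<epsilon>0 > 0"
    and nu_nonneg: "\<And>s. \<nu> s \<ge> 0"
    and T_interval: "is_interval T"
    and C_real: "\<And>s n x t. n < NL \<Longrightarrow> t \<in> T \<Longrightarrow> trig_poly L NF (\<lambda>k. C s n k t) x \<in> \<real>"
    and E_real: "\<And>x t. t \<in> T \<Longrightarrow> trig_poly L NF (\<lambda>k. E k t) x \<in> \<real>"
    and E_zero: "\<And>t. t \<in> T \<Longrightarrow> E 0 t = 0"
    and poisson: "\<And>k t. t \<in> T \<Longrightarrow> k \<in> {- int NF..int NF} \<Longrightarrow> k \<noteq> 0 \<Longrightarrow>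
        of_real \<epsilon>0 * (2 * of_real pi * \<i> / of_real L * of_int k) * E k t
          = of_real (vb - va) * (\<Sum>s\<in>{Electron, Ion}. of_real (q s) * C s 0 k t)"
    and f_def: "\<And>s x v t. f s x v t = vdf L va vb NL NF (\<lambda>n k. C s n k t) x v"
    and C_deriv: "\<And>s n k t. n < NL \<Longrightarrow> k \<in> {- int NF..int NF} \<Longrightarrow> t \<in> T \<Longrightarrow>
        (C s n k has_vector_derivative C' s n k t) (at t within T)"
    and vlasov: "\<And>s n k t. n < NL \<Longrightarrow> k \<in> {- int NF..int NF} \<Longrightarrow> t \<in> T \<Longrightarrow>
        C' s n k t
        + (2 * of_real pi * \<i> / of_real L * of_int k) * matA va vb NL (\<lambda>j. C s j k t) n
        - of_real (q s / m s) *
            conv L NF (\<lambda>k'. E k' t)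
              (\<lambda>x. matB va vb (\<lambda>j. trig_poly L NF (\<lambda>k'. C s j k' t) x) n
                   - of_real (\<gamma> s) * delta_v va vb (\<lambda>v. f s x v t * of_real (phi va vb n v)))
              k
        = matD NL (\<nu> s) (\<lambda>j. C s j k t) n"
  shows "\<forall>t\<in>T.
      let R = - of_real ((vb - va) * L) *
          (\<Sum>s\<in>{Electron, Ion}. of_real (q s * \<gamma> s) *
             conv L NF (\<lambda>k. E k t)
               (\<lambda>x. of_real (sigma_bar va vb)
                      * delta_v va vb (\<lambda>v. f s x v t * of_real (phi va vb 0 v))
                    + of_real (sigma1 va vb 1)
                      * delta_v va vb (\<lambda>v. f s x v t * of_real (phi va vb 1 v)))
               0)
      in ((\<lambda>\<tau>. momentum L va vb m (\<lambda>s x v. f s x v \<tau>)) has_vector_derivative R) (at t within T)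
         \<and> ((\<forall>s\<in>{Electron, Ion}. \<forall>x\<in>{0..L}. f s x va t = 0 \<and> f s x vb t = 0) \<longrightarrow> R = 0)"
proof
  fix t assume t: "t \<in> T"
  let ?b = "complex_of_real (sigma_bar va vb)" and ?s1 = "complex_of_real (sigma1 va vb 1)"
  define g where "g s n x = delta_v va vb (\<lambda>v. f s x v t * of_real (phi va vb n v))" for s n x
  define G where "G s n = conv L NF (\<lambda>k. E k t) (g s n) 0" for s n
  define H where "H s = conv L NF (\<lambda>k. E k t) (trig_poly L NF (\<lambda>k. C s 0 k t)) 0" for s
  define R where "R = - of_real ((vb - va) * L) * (\<Sum>s\<in>{Electron, Ion}. of_real (q s * \<gamma> s) *
      conv L NF (\<lambda>k. E k t) (\<lambda>x. ?b * g s 0 x + ?s1 * g s 1 x) 0)"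
  have f: "f s x v \<tau> = vdf L va vb NL NF (\<lambda>n k. C s n k \<tau>) x v" for s x v \<tau>
    by (rule f_def)
  have g_cont [continuous_intros]: "continuous_on S (g s n)" for S s n
    unfolding g_def f by (intro continuous_intros)
  \<comment> \<open>Up to constant factors, \<open>G s n\<close> is the penalty contribution in degree \<open>n\<close> and \<open>H s\<close> is the force
    per unit charge on species \<open>s\<close>, both at wave number \<open>0\<close>.\<close>
  have conv_g: "conv L NF (\<lambda>k. E k t) (\<lambda>x. ?b * g s 0 x + ?s1 * g s 1 x) 0 = ?b * G s 0 + ?s1 * G s 1" for s
    by (subst conv_add) (auto simp: G_def conv_cmult intro!: continuous_intros)

  have C0: "C' s 0 0 t = - of_real (q s / m s * \<gamma> s) * G s 0" for s
    using vlasov[of 0 0 t s] NL_ge t conv_cmult[of L NF "\<lambda>k. E k t" "- of_real (\<gamma> s)" "g s 0" 0]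
    by (simp add: matB_def matD_def g_def[symmetric] G_def[symmetric])
  have C1: "C' s 1 0 t = of_real (q s / m s) * (of_real (sigma2 va vb 1 0) * H s - of_real (\<gamma> s) * G s 1)" for s
  proof -
    have "conv L NF (\<lambda>k. E k t) (\<lambda>x. of_real (sigma2 va vb 1 0) * trig_poly L NF (\<lambda>k. C s 0 k t) x
        + (- of_real (\<gamma> s)) * g s 1 x) 0 = of_real (sigma2 va vb 1 0) * H s - of_real (\<gamma> s) * G s 1"
      by (subst conv_add) (auto simp: H_def G_def conv_cmult[of _ _ _ "- of_real (\<gamma> s)", simplified] 
          conv_cmult intro!: continuous_intros)
    then show ?thesis
      using vlasov[of 1 0 t s] NL_ge t
      by (simp add: matB_def matD_def g_def[symmetric])
  qed

  have force: "(\<Sum>s\<in>{Electron, Ion}. of_real (q s) * H s) = 0"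
  proof -
    have "(\<Sum>s\<in>{Electron, Ion}. of_real (q s) * H s)
        = (\<Sum>k\<in>{- int NF..int NF}. E k t * (\<Sum>s\<in>{Electron, Ion}. of_real (q s) * C s 0 (- k) t))"
      unfolding H_def conv_trig_poly_0[OF L_pos]
      by (simp add: sum_distrib_left sum.distrib distrib_left mult_ac)
    also have "\<dots> = 0"
    proof (rule poisson_force_zero[where c = "\<lambda>k. \<Sum>s\<in>{Electron, Ion}. of_real (q s) * C s 0 k t"])
      show "complex_of_real (vb - va) \<noteq> 0" using va_vb by simp
      show "(of_real \<epsilon>0 * (2 * of_real pi * \<i> / of_real L)) * of_int k * E k t
          = of_real (vb - va) * (\<Sum>s\<in>{Electron, Ion}. of_real (q s) * C s 0 k t)"
        if "k \<in> {- int NF..int NF}" "k \<noteq> 0" for k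
        using poisson[OF t that] by (simp only: mult.assoc)
      show "E 0 t = 0" by (rule E_zero[OF t])
    qed
    finally show ?thesis .
  qed

  have R: "of_real (L * (vb - va)) * (\<Sum>s\<in>{Electron, Ion}. of_real (m s) *
      (?b * C' s 0 0 t + ?s1 * C' s 1 0 t)) = R"
  proof -
    have "of_real (m s) * (?b * C' s 0 0 t + ?s1 * C' s 1 0 t)
        = of_real (q s) * H s - of_real (q s * \<gamma> s) * (?b * G s 0 + ?s1 * G s 1)" for s
    proof -
      have s12: "?s1 * of_real (sigma2 va vb 1 0) = 1"
        using sigma1_sigma2[OF va_vb] by (metis of_real_1 of_real_mult)
      have m: "of_real (m s) * complex_of_real (q s / m s) = of_real (q s)"
        using m_pos[of s] by simp
      have "of_real (m s) * (?b * C' s 0 0 t + ?s1 * C' s 1 0 t)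
          = (of_real (m s) * of_real (q s / m s)) * ((?s1 * of_real (sigma2 va vb 1 0)) * H s
             - of_real (\<gamma> s) * (?b * G s 0 + ?s1 * G s 1))"
        unfolding C0 C1 of_real_mult by algebra
      then show ?thesis unfolding s12 m by (simp add: algebra_simps)
    qed
    then have "(\<Sum>s\<in>{Electron, Ion}. of_real (m s) * (?b * C' s 0 0 t + ?s1 * C' s 1 0 t))
        = - (\<Sum>s\<in>{Electron, Ion}. of_real (q s * \<gamma> s) * (?b * G s 0 + ?s1 * G s 1))"
      using force by (simp only: sum_subtractf) simp
    then show ?thesis
      unfolding R_def conv_g by (simp only: mult.commute[of L] mult_minus_left mult_minus_right)
  qed

  have "((\<lambda>\<tau>. momentum L va vb m (\<lambda>s x v. f s x v \<tau>)) has_vector_derivative R) (at t within T)"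
  proof -
    have "(\<lambda>\<tau>. momentum L va vb m (\<lambda>s x v. f s x v \<tau>)) =
        (\<lambda>\<tau>. of_real (L * (vb - va)) * (\<Sum>s\<in>{Electron, Ion}. of_real (m s) *
          (?b * C s 0 0 \<tau> + ?s1 * C s 1 0 \<tau>)))"
      using NL_ge unfolding f by (subst momentum_vdf[OF L_pos va_vb]) auto
    moreover have "(C s n 0 has_vector_derivative C' s n 0 t) (at t within T)" if "n \<le> 1" for s n
      using C_deriv[of n 0 t s] NL_ge t that by simp
    then have "((\<lambda>\<tau>. of_real (L * (vb - va)) * (\<Sum>s\<in>{Electron, Ion}. of_real (m s) *
          (?b * C s 0 0 \<tau> + ?s1 * C s 1 0 \<tau>))) has_vector_derivative
        of_real (L * (vb - va)) * (\<Sum>s\<in>{Electron, Ion}. of_real (m s) *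
          (?b * C' s 0 0 t + ?s1 * C' s 1 0 t))) (at t within T)"
      by (intro has_vector_derivative_mult_right has_vector_derivative_sum has_vector_derivative_add) auto
    ultimately show ?thesis by (simp only: R)
  qed
  moreover have "R = 0" if bdry: "\<forall>s\<in>{Electron, Ion}. \<forall>x\<in>{0..L}. f s x va t = 0 \<and> f s x vb t = 0"
  proof -
    have "conv L NF (\<lambda>k. E k t) (\<lambda>x. ?b * g s 0 x + ?s1 * g s 1 x) 0 = 0" if "s \<in> {Electron, Ion}" for s
      using that bdry by (intro conv_eq_0) (auto simp: g_def delta_v_def)
    then show ?thesis unfolding R_def by simp
  qed
  ultimately show "let R = - of_real ((vb - va) * L) *
          (\<Sum>s\<in>{Electron, Ion}. of_real (q s * \<gamma> s) *
             conv L NF (\<lambda>k. E k t)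
               (\<lambda>x. of_real (sigma_bar va vb)
                      * delta_v va vb (\<lambda>v. f s x v t * of_real (phi va vb 0 v))
                    + of_real (sigma1 va vb 1)
                      * delta_v va vb (\<lambda>v. f s x v t * of_real (phi va vb 1 v)))
               0)
      in ((\<lambda>\<tau>. momentum L va vb m (\<lambda>s x v. f s x v \<tau>)) has_vector_derivative R) (at t within T)
         \<and> ((\<forall>s\<in>{Electron, Ion}. \<forall>x\<in>{0..L}. f s x va t = 0 \<and> f s x vb t = 0) \<longrightarrow> R = 0)"
    unfolding R_def g_def Let_def by blast
qed

end
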